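(* Let $\mathbb{F}$ be a field and $d\ge 0$ an integer. Let $\mathrm{AON}_d(\mathbb{F})$ be the set of almost orthogonal (AO) normalized solid invertible matrices in $\mathrm{Mat}_{d+1}(\mathbb{F})$, and $\mathrm{CS}_d(\mathbb{F})$ the set of isomorphism classes $[\Psi]$ of character systems $\Psi$ over $\mathbb{F}$ with diameter $d$. Then the following maps are inverses: (i) $\mathrm{AON}_d(\mathbb{F})\to\mathrm{CS}_d(\mathbb{F})$, $P\mapsto[\Psi_P]$; (ii) $\mathrm{CS}_d(\mathbb{F})\to\mathrm{AON}_d(\mathbb{F})$, $[\Psi]\mapsto P_\Psi$.
   Context: All algebras are associative, unital, over $\mathbb{F}$. Matrices in $\mathrm{Mat}_{d+1}(\mathbb{F})$ have rows and columns indexed by $0,1,\ldots,d$. For bases $\{u_i\}_{i=0}^d$, $\{v_i\}_{i=0}^d$ of a vector space, the transition matrix from $\{u_i\}$ to $\{v_i\}$ is the matrix $P$ with $v_j=\sum_{i=0}^d P_{i,j}u_i$. Matrices. An invertible $R\in\mathrm{Mat}_{d+1}(\mathbb{F})$ is solid if for both $R$ and $R^{-1}$ all entries in column $0$ and in row $0$ are nonzero. A solid invertible $R$ is normalized if all entries in column $0$ of $R$ are equal to $1$ and all entries in column $0$ of $R^{-1}$ are the same. $S,T$ are diagonally equivalent if $T=HSK$ for some invertible diagonal matrices $H,K$. $R$ is AO if it is invertible and $R^{\sf t}$ (transpose) is diagonally equivalent to $R^{-1}$. Character systems. A character algebra over $\mathbb{F}$ with diameter $d$ is a sequence $(\mathcal{C};\{x_i\}_{i=0}^d)$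 where $\mathcal{C}$ is a commutative $\mathbb{F}$-algebra and $x_i\in\mathcal{C}$ satisfy: (i) $x_0=1$; (ii) $\{x_i\}_{i=0}^d$ is a basis of $\mathcal{C}$; (iii) writing $x_ix_j=\sum_{h=0}^d p^h_{ij}x_h$, there are nonzero scalars $\{k_i\}_{i=0}^d$ with $p^0_{ij}=\delta_{i,j}k_i$ for $0\le i,j\le d$; (iv) there is an algebra homomorphism $\varphi:\mathcal{C}\to\mathbb{F}$ with $\varphi(x_i)=k_i$ for $0\le i\le d$. It is semisimple if $\mathcal{C}$ has a basis $\{e_i\}_{i=0}^d$ with $e_ie_j=\delta_{i,j}e_i$ and $1=\sum_{i=0}^d e_i$; these $e_i$ (unique up to permutation) are the primitive idempotents. Exactly one primitive idempotent is not sent to $0$ by $\varphi$; it is called trivial. A character system over $\mathbb{F}$ with diameter $d$ is a sequence $\Psi=(\mathcal{C};\{x_i\}_{i=0}^d;\{e_i\}_{i=0}^d)$ where $(\mathcal{C};\{x_i\}_{i=0}^d)$ is a semisimple character algebra over $\mathbb{F}$ and $\{e_i\}_{i=0}^d$ is an ordering of the primitive idempotents with $e_0$ trivial. An isomorphism of character systems $\Psi\to\Psi'$ is an algebra isomorphism $\mathcal{C}\to\mathcal{C}'$ sending $x_i\mapsto x'_i$, $e_i\mapsto e'_i$ for all $i$. The eigenmatrix $P_\Psi$ is the transition matrix from $\{e_i\}$ to $\{x_i\}$; it lies in $\mathrm{AON}_d(\mathbb{F})$ and depends only on $[\Psi]$. For $P\in\mathrm{AON}_d(\mathbb{F})$,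 $\Psi_P=(\mathcal{C};\{x_i\}_{i=0}^d;\{e_i\}_{i=0}^d)$, where $\mathcal{C}$ is the algebra with vector space basis $\{e_i\}_{i=0}^d$ and multiplication $e_ie_j=\delta_{i,j}e_i$, and $x_j=\sum_{i=0}^dP_{i,j}e_i$ for $0\le j\le d$; $\Psi_P$ is a character system over $\mathbb{F}$. *)

theory Defs
  imports "Jordan_Normal_Form.VS_Connect" "Jordan_Normal_Form.Gauss_Jordan_Elimination"
begin

text \<open>The ground field is a type \<open>'a\<close> of class \<open>field\<close>; its ring record is \<open>class_ring\<close>.
  Matrices with rows and columns \<open>0,\<dots>,d\<close> are the elements of \<open>carrier_mat (Suc d) (Suc d)\<close>.\<close>

section \<open>Almost orthogonal normalized solid invertible matrices\<close>

abbreviation inv_mat :: "'a::field mat \<Rightarrow> 'a mat" where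
  "inv_mat R \<equiv> the (mat_inverse R)"

definition solid :: "nat \<Rightarrow> 'a::field mat \<Rightarrow> bool" where
  "solid d R \<longleftrightarrow> R \<in> carrier_mat (Suc d) (Suc d) \<and> invertible_mat R \<and>
     (\<forall>i\<le>d. R $$ (i,0) \<noteq> 0 \<and> R $$ (0,i) \<noteq> 0) \<and>
     (\<forall>i\<le>d. inv_mat R $$ (i,0) \<noteq> 0 \<and> inv_mat R $$ (0,i) \<noteq> 0)"

definition normalized_solid :: "nat \<Rightarrow> 'a::field mat \<Rightarrow> bool" where
  "normalized_solid d R \<longleftrightarrow> solid d R \<and>
     (\<forall>i\<le>d. R $$ (i,0) = 1) \<and>
     (\<forall>i\<le>d. \<forall>j\<le>d. inv_mat R $$ (i,0) = inv_mat R $$ (j,0))"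

definition diagonally_equivalent :: "nat \<Rightarrow> 'a::field mat \<Rightarrow> 'a mat \<Rightarrow> bool" where
  "diagonally_equivalent d S T \<longleftrightarrow>
     (\<exists>H\<in>carrier_mat (Suc d) (Suc d). \<exists>K\<in>carrier_mat (Suc d) (Suc d).
        diagonal_mat H \<and> invertible_mat H \<and> diagonal_mat K \<and> invertible_mat K \<and> T = H * S * K)"

definition almost_orthogonal :: "nat \<Rightarrow> 'a::field mat \<Rightarrow> bool" where
  "almost_orthogonal d R \<longleftrightarrow> R \<in> carrier_mat (Suc d) (Suc d) \<and> invertible_mat R \<and>
     diagonally_equivalent d (transpose_mat R) (inv_mat R)"

definition AON :: "nat \<Rightarrow> 'a::field mat set" where
  "AON d = {R. normalized_solid d R \<and> almost_orthogonal d R}"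

section \<open>Algebras, bases, transition matrices\<close>

text \<open>The locale predicate \<open>algebra class_ring C\<close> of HOL-Algebra says that \<open>C\<close> is an associative,
  unital and \<^emph>\<open>commutative\<close> algebra over the ground field.\<close>

definition field_algebra :: "('a::field, 'a) module" where
  "field_algebra = \<lparr>carrier = UNIV, mult = (*), one = 1, zero = 0, add = (+), smult = (*)\<rparr>"

definition algebra_hom :: "('a::field, 'b) module \<Rightarrow> ('a, 'c) module \<Rightarrow> ('b \<Rightarrow> 'c) set" where
  "algebra_hom C D = Ring.ring_hom C D \<inter> LinearCombinations.module_hom class_ring C D"

text \<open>A basis is an indexed family here, so repetitions have to be excluded. Only the values of
  a family at the indices \<open>0,\<dots>,d\<close> matter, here and below.\<close>

definition basis_family :: "nat \<Rightarrow> ('a::field, 'c) module \<Rightarrow> (nat \<Rightarrow> 'c) \<Rightarrow> bool" where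
  "basis_family d C u \<longleftrightarrow> inj_on u {..d} \<and> vectorspace.basis class_ring C (u ` {..d})"

definition transition_matrix ::
  "nat \<Rightarrow> ('a::field, 'c) module \<Rightarrow> (nat \<Rightarrow> 'c) \<Rightarrow> (nat \<Rightarrow> 'c) \<Rightarrow> 'a mat" where
  "transition_matrix d C u v = (THE P. P \<in> carrier_mat (Suc d) (Suc d) \<and>
     (\<forall>j\<le>d. v j = (\<Oplus>\<^bsub>C\<^esub>i\<in>{..d}. P $$ (i,j) \<odot>\<^bsub>C\<^esub> u i)))"

section \<open>Character algebras and character systems\<close>

text \<open>\<open>p h i j\<close> is the coefficient of \<open>x h\<close> in the product of \<open>x i\<close> and \<open>x j\<close>.\<close>

definition structure_constants ::
  "nat \<Rightarrow> ('a::field, 'c) module \<Rightarrow> (nat \<Rightarrow> 'c) \<Rightarrow> (nat \<Rightarrow> nat \<Rightarrow> nat \<Rightarrow> 'a) \<Rightarrow> bool" where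
  "structure_constants d C x p \<longleftrightarrow>
     (\<forall>i\<le>d. \<forall>j\<le>d. x i \<otimes>\<^bsub>C\<^esub> x j = (\<Oplus>\<^bsub>C\<^esub>h\<in>{..d}. p h i j \<odot>\<^bsub>C\<^esub> x h))"

definition valencies ::
  "nat \<Rightarrow> ('a::field, 'c) module \<Rightarrow> (nat \<Rightarrow> 'c) \<Rightarrow> (nat \<Rightarrow> 'a) \<Rightarrow> bool" where
  "valencies d C x k \<longleftrightarrow> (\<forall>i\<le>d. k i \<noteq> 0) \<and>
     (\<exists>p. structure_constants d C x p \<and>
          (\<forall>i\<le>d. \<forall>j\<le>d. p 0 i j = (if i = j then k i else 0)))"

definition valency_hom ::
  "nat \<Rightarrow> ('a::field, 'c) module \<Rightarrow> (nat \<Rightarrow> 'c) \<Rightarrow> ('c \<Rightarrow> 'a) \<Rightarrow> bool" where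
  "valency_hom d C x \<phi> \<longleftrightarrow> \<phi> \<in> algebra_hom C field_algebra \<and>
     (\<exists>k. valencies d C x k \<and> (\<forall>i\<le>d. \<phi> (x i) = k i))"

definition character_algebra :: "nat \<Rightarrow> ('a::field, 'c) module \<Rightarrow> (nat \<Rightarrow> 'c) \<Rightarrow> bool" where
  "character_algebra d C x \<longleftrightarrow> algebra class_ring C \<and> x 0 = \<one>\<^bsub>C\<^esub> \<and> basis_family d C x \<and>
     (\<exists>\<phi>. valency_hom d C x \<phi>)"

text \<open>An ordering \<open>e 0,\<dots>,e d\<close> of the primitive idempotents of a semisimple \<open>C\<close>; semisimplicity
  of \<open>C\<close> is the existence of such a family.\<close>

definition primitive_idempotents :: "nat \<Rightarrow> ('a::field, 'c) module \<Rightarrow> (nat \<Rightarrow> 'c) \<Rightarrow> bool" where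
  "primitive_idempotents d C e \<longleftrightarrow> basis_family d C e \<and>
     (\<forall>i\<le>d. \<forall>j\<le>d. e i \<otimes>\<^bsub>C\<^esub> e j = (if i = j then e i else \<zero>\<^bsub>C\<^esub>)) \<and>
     \<one>\<^bsub>C\<^esub> = (\<Oplus>\<^bsub>C\<^esub>i\<in>{..d}. e i)"

text \<open>On a character algebra \<open>valency_hom\<close> determines its homomorphism uniquely on the carrier,
  because it prescribes its values on the basis \<open>x\<close>; so the quantifier over \<open>\<phi>\<close> is harmless.\<close>

definition trivial_idempotent ::
  "nat \<Rightarrow> ('a::field, 'c) module \<Rightarrow> (nat \<Rightarrow> 'c) \<Rightarrow> 'c \<Rightarrow> bool" where
  "trivial_idempotent d C x u \<longleftrightarrow> (\<exists>\<phi>. valency_hom d C x \<phi> \<and> \<phi> u \<noteq> 0)"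

type_synonym ('a, 'c) char_system = "('a, 'c) module \<times> (nat \<Rightarrow> 'c) \<times> (nat \<Rightarrow> 'c)"

definition character_system :: "nat \<Rightarrow> ('a::field, 'c) char_system \<Rightarrow> bool" where
  "character_system d = (\<lambda>(C, x, e). character_algebra d C x \<and> primitive_idempotents d C e \<and>
     trivial_idempotent d C x (e 0))"

definition char_system_iso ::
  "nat \<Rightarrow> ('a::field, 'b) char_system \<Rightarrow> ('a, 'c) char_system \<Rightarrow> bool" where
  "char_system_iso d = (\<lambda>(C, x, e) (C', x', e').
     \<exists>f. f \<in> algebra_hom C C' \<and> bij_betw f (carrier C) (carrier C') \<and>
         (\<forall>i\<le>d. f (x i) = x' i \<and> f (e i) = e' i))"

definition eigenmatrix :: "nat \<Rightarrow> ('a::field, 'c) char_system \<Rightarrow> 'a mat" where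
  "eigenmatrix d = (\<lambda>(C, x, e). transition_matrix d C e x)"

section \<open>Isomorphism classes\<close>

text \<open>A set of isomorphism classes needs a fixed type for the carriers. We use \<open>'a vec\<close>, which
  contains all coordinate spaces over the ground field and hence a copy of every
  finite-dimensional algebra. The class of a system \<open>\<Psi>\<close> over any type \<open>'c\<close> consists of the systems
  over \<open>'a vec\<close> that are isomorphic to \<open>\<Psi>\<close>.\<close>

definition iso_class :: "nat \<Rightarrow> ('a::field, 'c) char_system \<Rightarrow> ('a, 'a vec) char_system set" where
  "iso_class d \<Psi> = {\<Phi>. character_system d \<Phi> \<and> char_system_iso d \<Phi> \<Psi>}"

definition CS :: "nat \<Rightarrow> ('a::field, 'a vec) char_system set set" where
  "CS d = {iso_class d \<Psi> | \<Psi> :: ('a, 'a vec) char_system. character_system d \<Psi>}"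

text \<open>The common eigenmatrix of the members of a class.\<close>

definition class_eigenmatrix :: "nat \<Rightarrow> ('a::field, 'a vec) char_system set \<Rightarrow> 'a mat" where
  "class_eigenmatrix d c = (THE P. \<exists>\<Psi>\<in>c. eigenmatrix d \<Psi> = P)"

section \<open>The character system of a matrix\<close>

text \<open>The algebra with basis \<open>e\<^sub>i = unit_vec (Suc d) i\<close> and \<open>e\<^sub>i e\<^sub>j = \<delta>\<^sub>i\<^sub>j e\<^sub>i\<close>: by
  bilinearity its product is the entrywise one.\<close>

definition coord_algebra :: "nat \<Rightarrow> ('a::field, 'a vec) module" where
  "coord_algebra d = \<lparr>carrier = carrier_vec (Suc d),
     mult = (\<lambda>u v. vec (Suc d) (\<lambda>i. u $ i * v $ i)), one = vec (Suc d) (\<lambda>_. 1),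
     zero = 0\<^sub>v (Suc d), add = (+), smult = (\<cdot>\<^sub>v)\<rparr>"

lemma coord_algebra_unit_vec:
  assumes "i \<le> d" "j \<le> d"
  shows "unit_vec (Suc d) i \<otimes>\<^bsub>coord_algebra d\<^esub> unit_vec (Suc d) j =
    (if i = j then unit_vec (Suc d) i else \<zero>\<^bsub>coord_algebra d\<^esub>)"
  using assms by (auto simp: coord_algebra_def unit_vec_def)

definition Psi :: "nat \<Rightarrow> 'a::field mat \<Rightarrow> ('a, 'a vec) char_system" where
  "Psi d P = (coord_algebra d,
     (\<lambda>j. \<Oplus>\<^bsub>coord_algebra d\<^esub>i\<in>{..d}. P $$ (i,j) \<odot>\<^bsub>coord_algebra d\<^esub> unit_vec (Suc d) i),
     unit_vec (Suc d))"

end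

theory Submission
  imports Defs
begin

text \<open>Let \<open>e\<^sub>0,\<dots>,e\<^sub>d\<close> be the primitive idempotents of \<open>C\<close>. The map \<open>v \<mapsto> \<Sum>\<^sub>i v\<^sub>i e\<^sub>i\<close> is an algebra
  isomorphism from the coordinate algebra to \<open>C\<close>, so a candidate system \<open>(C, x, e)\<close> is determined up
  to isomorphism by the matrix \<open>P\<close> whose column \<open>j\<close> contains the coordinates of \<open>x\<^sub>j\<close>. A homomorphism to
  the field that does not vanish at \<open>e\<^sub>0\<close> is the coordinate at \<open>e\<^sub>0\<close>, hence \<open>k\<^sub>j = P\<^sub>0\<^sub>j\<close>. With \<open>Q\<close> the inverse
  of \<open>P\<close> the structure constants satisfy \<open>p\<^sup>0\<^sub>i\<^sub>j = \<Sum>\<^sub>l Q\<^sub>0\<^sub>l P\<^sub>l\<^sub>i P\<^sub>l\<^sub>j\<close>, and this equals \<open>\<delta>\<^sub>i\<^sub>j k\<^sub>i\<close> exactly when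
  \<open>Q\<^sub>0\<^sub>l P\<^sub>l\<^sub>i = P\<^sub>0\<^sub>i Q\<^sub>i\<^sub>l\<close>. Together with \<open>P\<^sub>l\<^sub>0 = 1\<close> and \<open>P\<^sub>0\<^sub>i \<noteq> 0\<close> these equations also describe the almost
  orthogonal normalized solid invertible matrices. Both maps of the theorem therefore amount to
  passing between a system and its matrix of coordinates.\<close>

section \<open>Almost orthogonal normalized solid matrices\<close>

text \<open>As a simp rule \<open>col_carrier_vec\<close> leaves the number of columns undetermined, which makes the
  simplifier diverge.\<close>

declare col_carrier_vec [simp del]

section \<open>Inverses and diagonal matrices\<close>

lemma invertible_matI:
  assumes "P \<in> carrier_mat n n" "Q \<in> carrier_mat n n" "P * Q = 1\<^sub>m n" "Q * P = 1\<^sub>m n"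
  shows "invertible_mat P"
  using assms unfolding invertible_mat_def inverts_mat_def by auto

text \<open>\<open>mat_inverse\<close> returns \<open>None\<close> only for matrices that are not
  units of the matrix ring. A two-sided inverse therefore forces a result \<open>B\<close>, and
  associativity gives \<open>B = Q\<close>.\<close>

lemma inv_mat_eqI:
  fixes P :: "'a::field mat"
  assumes P: "P \<in> carrier_mat n n" and Q: "Q \<in> carrier_mat n n"
    and PQ: "P * Q = 1\<^sub>m n" and QP: "Q * P = 1\<^sub>m n"
  shows "inv_mat P = Q"
proof -
  have "P \<in> Units (ring_mat TYPE('a) n ())"
    unfolding Units_def using assms by (auto simp: ring_mat_def)
  then obtain B where B: "mat_inverse P = Some B"
    using mat_inverse(1)[OF P, where b = "()"] by (cases "mat_inverse P") auto
  then have "B * P = 1\<^sub>m n" "B \<in> carrier_mat n n" using mat_inverse(2)[OF P] by auto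
  then have "B = Q"
    using assoc_mult_mat[of B n n P n Q n] P Q PQ by simp
  then show ?thesis using B by simp
qed

lemma invertible_matE:
  fixes P :: "'a::field mat"
  assumes P: "P \<in> carrier_mat n n" and inv: "invertible_mat P"
  obtains Q where "Q \<in> carrier_mat n n" "P * Q = 1\<^sub>m n" "Q * P = 1\<^sub>m n"
proof -
  obtain Q where PQ: "P * Q = 1\<^sub>m n" and QP: "Q * P = 1\<^sub>m (dim_row Q)"
    using inv P unfolding invertible_mat_def inverts_mat_def by auto
  \<comment> \<open>\<open>invertible_mat\<close> leaves the size of the inverse open; comparing the
    numbers of columns in both equations fixes it.\<close>
  have "dim_col Q = n" using arg_cong[OF PQ, of dim_col] by simp
  moreover have "dim_row Q = n" using arg_cong[OF QP, of dim_col] P by simp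
  ultimately show thesis using that[of Q] PQ QP by auto
qed

lemma diagonal_mat_eq_mat_diag:
  assumes "H \<in> carrier_mat n n" "diagonal_mat H"
  shows "H = mat_diag n (\<lambda>i. H $$ (i,i))"
  using assms unfolding diagonal_mat_def mat_diag_def by (intro eq_matI) auto

lemma mult_diagonal_mat_entry:
  fixes A :: "'a::field mat"
  assumes "H \<in> carrier_mat n n" "diagonal_mat H" "K \<in> carrier_mat n n" "diagonal_mat K"
    "A \<in> carrier_mat n n" "i < n" "j < n"
  shows "(H * A * K) $$ (i,j) = H $$ (i,i) * A $$ (i,j) * K $$ (j,j)"
proof -
  have "H * A * K = mat_diag n (\<lambda>i. H $$ (i,i)) * A * mat_diag n (\<lambda>i. K $$ (i,i))"
    using diagonal_mat_eq_mat_diag assms by metis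
  then show ?thesis
    using assms by (simp add: mat_diag_mult_left[of _ n n] mat_diag_mult_right[of _ n n])
qed

lemma mat_diag_invertible:
  fixes f :: "nat \<Rightarrow> 'a::field"
  assumes "\<And>i. i < n \<Longrightarrow> f i \<noteq> 0"
  shows "invertible_mat (mat_diag n f)"
proof (rule invertible_matI)
  have "mat_diag n (\<lambda>i. f i * inverse (f i)) = 1\<^sub>m n" "mat_diag n (\<lambda>i. inverse (f i) * f i) = 1\<^sub>m n"
    using assms by (auto simp: mat_diag_def)
  then show "mat_diag n f * mat_diag n (\<lambda>i. inverse (f i)) = 1\<^sub>m n"
    "mat_diag n (\<lambda>i. inverse (f i)) * mat_diag n f = 1\<^sub>m n" by simp_all
qed auto

lemma mult_mat_vec_bij:
  fixes P :: "'a::field mat"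
  assumes P: "P \<in> carrier_mat n n" and Q: "Q \<in> carrier_mat n n"
    and PQ: "P * Q = 1\<^sub>m n" and QP: "Q * P = 1\<^sub>m n"
  shows "bij_betw ((*\<^sub>v) P) (carrier_vec n) (carrier_vec n)"
proof (rule bij_betw_byWitness[where f' = "(*\<^sub>v) Q"])
  show "\<forall>v\<in>carrier_vec n. Q *\<^sub>v (P *\<^sub>v v) = v"
    using assoc_mult_mat_vec[OF Q P] QP by simp
  show "\<forall>v\<in>carrier_vec n. P *\<^sub>v (Q *\<^sub>v v) = v"
    using assoc_mult_mat_vec[OF P Q] PQ by simp
qed (use P Q in auto)

lemma mult_unit_vec_eq_col:
  fixes P :: "'a::semiring_1 mat"
  assumes "P \<in> carrier_mat n m" "j < m"
  shows "P *\<^sub>v unit_vec m j = col P j"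
  using assms by (intro eq_vecI) auto

text \<open>The last condition says \<open>D Q = P\<^sup>T E\<close>, where \<open>Q\<close> is the inverse of \<open>P\<close> and the diagonal matrices
  \<open>D\<close> and \<open>E\<close> are formed from row \<open>0\<close> of \<open>P\<close> and of \<open>Q\<close>. On the algebra side it says
  \<open>p\<^sup>0\<^sub>i\<^sub>j = \<delta>\<^sub>i\<^sub>j k\<^sub>i\<close> with \<open>k\<^sub>i = P\<^sub>0\<^sub>i\<close>; so it links \<open>AON\<close> to character systems.\<close>

definition eigenmatrix_pair :: "nat \<Rightarrow> 'a::field mat \<Rightarrow> 'a mat \<Rightarrow> bool" where
  "eigenmatrix_pair d P Q \<longleftrightarrow>
     P \<in> carrier_mat (Suc d) (Suc d) \<and> Q \<in> carrier_mat (Suc d) (Suc d) \<and>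
     P * Q = 1\<^sub>m (Suc d) \<and> Q * P = 1\<^sub>m (Suc d) \<and>
     (\<forall>i\<le>d. P $$ (i,0) = 1 \<and> P $$ (0,i) \<noteq> 0) \<and>
     (\<forall>i\<le>d. \<forall>l\<le>d. P $$ (0,i) * Q $$ (i,l) = Q $$ (0,l) * P $$ (l,i))"

text \<open>Dividing the last condition by \<open>P $$ (0,i)\<close> exhibits \<open>Q\<close> as
  the transpose of \<open>P\<close> rescaled by two diagonal matrices. The properties of row and
  column 0 of \<open>Q\<close> follow from the same condition.\<close>

lemma AON_if_eigenmatrix_pair:
  assumes "eigenmatrix_pair d P Q"
  shows "P \<in> AON d"
proof -
  have P: "P \<in> carrier_mat (Suc d) (Suc d)" and Q: "Q \<in> carrier_mat (Suc d) (Suc d)"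
    and PQ: "P * Q = 1\<^sub>m (Suc d)" and QP: "Q * P = 1\<^sub>m (Suc d)"
    and P1: "\<And>i. i \<le> d \<Longrightarrow> P $$ (i,0) = 1" and P0: "\<And>i. i \<le> d \<Longrightarrow> P $$ (0,i) \<noteq> 0"
    and eq: "\<And>i l. i \<le> d \<Longrightarrow> l \<le> d \<Longrightarrow> P $$ (0,i) * Q $$ (i,l) = Q $$ (0,l) * P $$ (l,i)"
    using assms unfolding eigenmatrix_pair_def by auto
  have inv: "invertible_mat P" and invP: "inv_mat P = Q"
    using invertible_matI[OF P Q PQ QP] inv_mat_eqI[OF P Q PQ QP] by auto
  have Q0: "Q $$ (0,l) \<noteq> 0" if l: "l \<le> d" for l
  proof
    assume "Q $$ (0,l) = 0"
    \<comment> \<open>A zero in row 0 would make all of column \<open>l\<close> of \<open>Q\<close>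
      vanish, against \<open>(P * Q) $$ (l,l) = 1\<close>.\<close>
    then have "Q $$ (i,l) = 0" if "i \<le> d" for i using eq[OF that l] P0[OF that] by simp
    then have "(P * Q) $$ (l,l) = 0"
      using P Q l by (simp add: scalar_prod_def)
    then show False using l by (simp add: PQ)
  qed
  \<comment> \<open>At \<open>l = 0\<close> both sides of the condition contain the factor
    \<open>P $$ (0,i)\<close>, which cancels.\<close>
  have Qc: "Q $$ (i,0) = Q $$ (0,0)" if "i \<le> d" for i
    using eq[OF that, of 0] P0[OF that] by simp
  have Qnz: "Q $$ (i,0) \<noteq> 0" if "i \<le> d" for i
    unfolding Qc[OF that] using Q0 by simp
  have "solid d P" unfolding solid_def invP using P inv P1 P0 Q0 Qnz by auto
  then have norm: "normalized_solid d P"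
    unfolding normalized_solid_def invP using P1 Qc by metis
  let ?H = "mat_diag (Suc d) (\<lambda>i. inverse (P $$ (0,i)))" and ?K = "mat_diag (Suc d) (\<lambda>l. Q $$ (0,l))"
  have diag: "diagonal_mat ?H" "diagonal_mat ?K" by (auto simp: diagonal_mat_def mat_diag_def)
  have "Q = ?H * P\<^sup>T * ?K"
  proof (rule eq_matI)
    fix i l assume "i < dim_row (?H * P\<^sup>T * ?K)" "l < dim_col (?H * P\<^sup>T * ?K)"
    then have il: "i \<le> d" "l \<le> d" by (auto simp: mat_diag_def)
    then have "(?H * P\<^sup>T * ?K) $$ (i,l) = inverse (P $$ (0,i)) * P $$ (l,i) * Q $$ (0,l)"
      using mult_diagonal_mat_entry[OF _ diag(1) _ diag(2), of "Suc d" "P\<^sup>T" i l] P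
      by (simp add: mat_diag_def)
    also have "\<dots> = inverse (P $$ (0,i)) * (P $$ (0,i) * Q $$ (i,l))"
      unfolding eq[OF il] by (simp only: mult_ac)
    also have "\<dots> = Q $$ (i,l)" using P0[OF il(1)] by simp
    finally show "Q $$ (i,l) = (?H * P\<^sup>T * ?K) $$ (i,l)" by simp
  qed (use Q in \<open>auto simp: mat_diag_def\<close>)
  moreover have "invertible_mat ?H" "invertible_mat ?K"
    using P0 Q0 by (auto intro!: mat_diag_invertible simp: less_Suc_eq_le)
  ultimately have "diagonally_equivalent d P\<^sup>T (inv_mat P)"
    unfolding diagonally_equivalent_def invP using diag mat_diag_dim by blast
  then show ?thesis
    unfolding AON_def almost_orthogonal_def using norm P inv by simp
qed

text \<open>The diagonal matrices \<open>H\<close> and \<open>K\<close> are unknown at first.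
  Normalization ties \<open>H\<close> to row 0 of \<open>P\<close> up to the scalar
  \<open>H $$ (0,0)\<close>, and row 0 of \<open>Q\<close> then equals that scalar times the
  diagonal of \<open>K\<close>.\<close>

lemma eigenmatrix_pair_if_AON:
  assumes "P \<in> AON d"
  shows "\<exists>Q. eigenmatrix_pair d P Q"
proof -
  have norm: "normalized_solid d P" and ao: "almost_orthogonal d P" using assms by (auto simp: AON_def)
  have P: "P \<in> carrier_mat (Suc d) (Suc d)" and inv: "invertible_mat P"
    using ao by (auto simp: almost_orthogonal_def)
  obtain Q where Q: "Q \<in> carrier_mat (Suc d) (Suc d)"
    and PQ: "P * Q = 1\<^sub>m (Suc d)" and QP: "Q * P = 1\<^sub>m (Suc d)"
    using invertible_matE[OF P inv] by blast
  have invP: "inv_mat P = Q" using inv_mat_eqI[OF P Q PQ QP] .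
  have P1: "P $$ (i,0) = 1" and P0: "P $$ (0,i) \<noteq> 0" and Qc: "Q $$ (i,0) = Q $$ (0,0)"
    and Qnz: "Q $$ (i,0) \<noteq> 0" if "i \<le> d" for i
    using norm that unfolding normalized_solid_def solid_def invP by blast+
  obtain H K where HK: "H \<in> carrier_mat (Suc d) (Suc d)" "diagonal_mat H"
      "K \<in> carrier_mat (Suc d) (Suc d)" "diagonal_mat K" and QHK: "Q = H * P\<^sup>T * K"
    using ao unfolding almost_orthogonal_def diagonally_equivalent_def invP by blast
  have Qil: "Q $$ (i,l) = H $$ (i,i) * P $$ (l,i) * K $$ (l,l)" if "i \<le> d" "l \<le> d" for i l
    using mult_diagonal_mat_entry[OF HK, of "P\<^sup>T" i l] P that unfolding QHK by simp
  have K0: "K $$ (0,0) \<noteq> 0" using Qil[of 0 0] Qnz[of 0] by auto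
  \<comment> \<open>The entries \<open>(i,0)\<close> and \<open>(0,0)\<close> of \<open>Q\<close>
    agree; both contain the factor \<open>K $$ (0,0)\<close>, which cancels.\<close>
  have H: "H $$ (i,i) * P $$ (0,i) = H $$ (0,0)" if "i \<le> d" for i
  proof -
    have "(H $$ (i,i) * P $$ (0,i)) * K $$ (0,0) = H $$ (0,0) * K $$ (0,0)"
      using Qil[OF that, of 0] Qil[of 0 0] Qc[OF that] P1[of 0] by (metis le0 mult_1_right)
    then show ?thesis using K0 mult_right_cancel by blast
  qed
  have "P $$ (0,i) * Q $$ (i,l) = Q $$ (0,l) * P $$ (l,i)" if il: "i \<le> d" "l \<le> d" for i l
  proof -
    have "P $$ (0,i) * Q $$ (i,l) = (H $$ (i,i) * P $$ (0,i)) * P $$ (l,i) * K $$ (l,l)"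
      unfolding Qil[OF il] by (simp only: mult_ac)
    also have "\<dots> = Q $$ (0,l) * P $$ (l,i)"
      unfolding H[OF il(1)] Qil[OF le0 il(2)] P1[OF il(2)] by (simp only: mult_ac mult_1_left mult_1_right)
    finally show ?thesis .
  qed
  then show ?thesis
    unfolding eigenmatrix_pair_def using P Q PQ QP P1 P0 by blast
qed

section \<open>Bases of algebras in coordinates\<close>

text \<open>The coefficients are packed into a vector so that a change of basis becomes a
  matrix-vector product.\<close>

definition comb :: "nat \<Rightarrow> ('a::field, 'c) module \<Rightarrow> (nat \<Rightarrow> 'c) \<Rightarrow> 'a vec \<Rightarrow> 'c" where
  "comb d C u v = (\<Oplus>\<^bsub>C\<^esub>i\<in>{..d}. v $ i \<odot>\<^bsub>C\<^esub> u i)"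

locale class_algebra = algebra class_ring C
  for C :: "('a::field, 'c) module" (structure)
begin

sublocale vectorspace "class_ring :: 'a ring" C
  by (simp add: vectorspace_def class_field module_axioms)

lemma smult_closed_class [simp]: "x \<in> carrier C \<Longrightarrow> a \<odot>\<^bsub>C\<^esub> x \<in> carrier C"
  by simp

lemma comb_closed [simp]: "u \<in> {..d} \<rightarrow> carrier C \<Longrightarrow> comb d C u v \<in> carrier C"
  unfolding comb_def by (rule finsum_closed) auto

lemma comb_cong:
  assumes "u' \<in> {..d} \<rightarrow> carrier C" "\<And>i. i \<le> d \<Longrightarrow> v $ i = w $ i" "\<And>i. i \<le> d \<Longrightarrow> u i = u' i"
  shows "comb d C u v = comb d C u' w"
  unfolding comb_def by (rule finsum_cong') (use assms in auto)

lemma comb_add: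
  assumes "u \<in> {..d} \<rightarrow> carrier C" "v \<in> carrier_vec (Suc d)" "w \<in> carrier_vec (Suc d)"
  shows "comb d C u (v + w) = comb d C u v \<oplus>\<^bsub>C\<^esub> comb d C u w"
proof -
  have "comb d C u (v + w) = (\<Oplus>\<^bsub>C\<^esub>i\<in>{..d}. v $ i \<odot>\<^bsub>C\<^esub> u i \<oplus>\<^bsub>C\<^esub> w $ i \<odot>\<^bsub>C\<^esub> u i)"
    unfolding comb_def
    by (rule finsum_cong') (use assms smult_l_distr in \<open>auto simp: Pi_iff\<close>)
  also have "\<dots> = comb d C u v \<oplus>\<^bsub>C\<^esub> comb d C u w"
    unfolding comb_def by (rule finsum_addf) (use assms in auto)
  finally show ?thesis .
qed

lemma comb_smult:
  assumes "u \<in> {..d} \<rightarrow> carrier C" "v \<in> carrier_vec (Suc d)"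
  shows "comb d C u (a \<cdot>\<^sub>v v) = a \<odot>\<^bsub>C\<^esub> comb d C u v"
proof -
  have "comb d C u (a \<cdot>\<^sub>v v) = (\<Oplus>\<^bsub>C\<^esub>i\<in>{..d}. a \<odot>\<^bsub>C\<^esub> (v $ i \<odot>\<^bsub>C\<^esub> u i))"
    unfolding comb_def
    by (rule finsum_cong') (use assms smult_assoc1 in \<open>auto simp: Pi_iff\<close>)
  also have "\<dots> = a \<odot>\<^bsub>C\<^esub> comb d C u v"
    unfolding comb_def by (rule finsum_smult_ldistr[symmetric]) (use assms in auto)
  finally show ?thesis .
qed

lemma comb_unit_vec:
  assumes "u \<in> {..d} \<rightarrow> carrier C" "j \<le> d"
  shows "comb d C u (unit_vec (Suc d) j) = u j"
proof -
  have "comb d C u (unit_vec (Suc d) j) = (\<Oplus>\<^bsub>C\<^esub>i\<in>{..d}. if j = i then u i else \<zero>\<^bsub>C\<^esub>)"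
    unfolding comb_def
    by (rule finsum_cong')
      (use assms smult_one smult_l_null in \<open>auto simp: unit_vec_def Pi_iff\<close>)
  also have "\<dots> = u j"
    by (rule add.finprod_singleton) (use assms in auto)
  finally show ?thesis .
qed

lemma comb_zero:
  assumes "u \<in> {..d} \<rightarrow> carrier C"
  shows "comb d C u (0\<^sub>v (Suc d)) = \<zero>\<^bsub>C\<^esub>"
proof -
  have "(0 :: 'a) \<cdot>\<^sub>v 0\<^sub>v (Suc d) = 0\<^sub>v (Suc d)" by auto
  then show ?thesis
    using comb_smult[OF assms, of "0\<^sub>v (Suc d)" 0] comb_closed[OF assms] smult_l_null by simp
qed

lemma comb_eq_lincomb:
  assumes "u \<in> {..d} \<rightarrow> carrier C" "inj_on u {..d}" "\<And>i. i \<le> d \<Longrightarrow> a (u i) = v $ i"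
  shows "lincomb a (u ` {..d}) = comb d C u v"
proof -
  have "lincomb a (u ` {..d}) = (\<Oplus>\<^bsub>C\<^esub>i\<in>{..d}. a (u i) \<odot>\<^bsub>C\<^esub> u i)"
    unfolding lincomb_def by (rule add.finprod_reindex) (use assms in auto)
  also have "\<dots> = comb d C u v"
    unfolding comb_def by (rule finsum_cong') (use assms in auto)
  finally show ?thesis .
qed

text \<open>Injectivity of the coordinate map corresponds to linear independence together with
  distinctness of the family, surjectivity to spanning. All later arguments about bases go through
  this bijection.\<close>

lemma basis_family_iff:
  "basis_family d C u \<longleftrightarrow>
     u \<in> {..d} \<rightarrow> carrier C \<and> bij_betw (comb d C u) (carrier_vec (Suc d)) (carrier C)"
proof (intro iffI conjI)
  assume b: "basis_family d C u"
  then have inj: "inj_on u {..d}" and li: "lin_indpt (u ` {..d})"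
    and gen: "gen_set (u ` {..d})" and sub: "u ` {..d} \<subseteq> carrier C"
    unfolding basis_family_def basis_def by auto
  show u: "u \<in> {..d} \<rightarrow> carrier C" using sub by auto
  \<comment> \<open>\<open>lincomb\<close> indexes coefficients by module elements; distinctness of
    the family allows the passage from indices.\<close>
  have a: "\<exists>a. \<forall>i\<le>d. a (u i) = v $ i" for v :: "'a vec"
    by (rule exI[of _ "\<lambda>y. v $ the_inv_into {..d} u y"]) (simp add: the_inv_into_f_f[OF inj])
  show "bij_betw (comb d C u) (carrier_vec (Suc d)) (carrier C)"
  proof (rule bij_betw_imageI)
    show "inj_on (comb d C u) (carrier_vec (Suc d))"
    proof (rule inj_onI)
      fix v w assume v: "v \<in> carrier_vec (Suc d)" and w: "w \<in> carrier_vec (Suc d)"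
        and eq: "comb d C u v = comb d C u w"
      have vw: "v + (-1) \<cdot>\<^sub>v w \<in> carrier_vec (Suc d)" using v w by simp
      \<comment> \<open>Injectivity is reduced to a trivial kernel: the difference of
        \<open>v\<close> and \<open>w\<close> is sent to zero.\<close>
      have "comb d C u (v + (-1) \<cdot>\<^sub>v w) = comb d C u w \<oplus>\<^bsub>C\<^esub> comb d C u ((-1) \<cdot>\<^sub>v w)"
        using v w comb_add[OF u v, of "(-1) \<cdot>\<^sub>v w"] eq by simp
      also have "\<dots> = comb d C u (w + (-1) \<cdot>\<^sub>v w)"
        using w comb_add[OF u w, of "(-1) \<cdot>\<^sub>v w"] by simp
      also have "w + (-1) \<cdot>\<^sub>v w = 0\<^sub>v (Suc d)" using w by auto
      finally have z: "comb d C u (v + (-1) \<cdot>\<^sub>v w) = \<zero>\<^bsub>C\<^esub>" by (simp add: comb_zero[OF u])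
      obtain a where a: "\<forall>i\<le>d. a (u i) = (v + (-1) \<cdot>\<^sub>v w) $ i" using a by blast
      then have "lincomb a (u ` {..d}) = \<zero>\<^bsub>C\<^esub>"
        using comb_eq_lincomb[OF u inj, of a "v + (-1) \<cdot>\<^sub>v w"] z by simp
      then have "a (u i) = 0" if "i \<le> d" for i
        using lin_dep_crit[of "u ` {..d}" "u ` {..d}" a "u i"] li that by auto
      then show "v = w" using a v w by (intro eq_vecI) (auto simp: less_Suc_eq_le)
    qed
    show "comb d C u ` carrier_vec (Suc d) = carrier C"
    proof
      show "comb d C u ` carrier_vec (Suc d) \<subseteq> carrier C" using u by auto
      show "carrier C \<subseteq> comb d C u ` carrier_vec (Suc d)"
      proof
        fix y assume "y \<in> carrier C"
        then have "y \<in> span (u ` {..d})" using gen by simp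
        then obtain a where "lincomb a (u ` {..d}) = y"
          using finite_in_span[OF _ sub] by auto
        then have "y = comb d C u (Matrix.vec (Suc d) (\<lambda>i. a (u i)))"
          using comb_eq_lincomb[OF u inj, of a "Matrix.vec (Suc d) (\<lambda>i. a (u i))"] by simp
        then show "y \<in> comb d C u ` carrier_vec (Suc d)" by auto
      qed
    qed
  qed
next
  assume "u \<in> {..d} \<rightarrow> carrier C \<and> bij_betw (comb d C u) (carrier_vec (Suc d)) (carrier C)"
  then have u: "u \<in> {..d} \<rightarrow> carrier C" and inj: "inj_on (comb d C u) (carrier_vec (Suc d))"
    and surj: "comb d C u ` carrier_vec (Suc d) = carrier C" by (auto simp: bij_betw_def)
  have u_inj: "inj_on u {..d}"
  proof (rule inj_onI)
    fix i j assume "i \<in> {..d}" "j \<in> {..d}" "u i = u j"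
    \<comment> \<open>\<open>u i\<close> and \<open>u j\<close> are the images of unit vectors,
      which the injective coordinate map separates.\<close>
    then have "(unit_vec (Suc d) i :: 'a vec) = unit_vec (Suc d) j"
      using inj_onD[OF inj, of "unit_vec (Suc d) i" "unit_vec (Suc d) j"] comb_unit_vec[OF u]
      by auto
    then show "i = j" using \<open>i \<in> {..d}\<close> \<open>j \<in> {..d}\<close>
      by (metis atMost_iff index_unit_vec(1) less_Suc_eq_le zero_neq_one)
  qed
  have sub: "u ` {..d} \<subseteq> carrier C" using u by auto
  have li: "lin_indpt (u ` {..d})"
  proof (rule finite_lin_indpt2)
    fix a :: "'c \<Rightarrow> 'a" assume z: "lincomb a (u ` {..d}) = \<zero>\<^bsub>C\<^esub>"
    let ?v = "Matrix.vec (Suc d) (\<lambda>i. a (u i))"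
    have "comb d C u ?v = comb d C u (0\<^sub>v (Suc d))"
      using comb_eq_lincomb[OF u u_inj, of a ?v] z comb_zero[OF u] by simp
    then have v: "?v = 0\<^sub>v (Suc d)" using inj by (auto dest: inj_onD)
    have "a (u i) = 0" if "i \<le> d" for i
      using arg_cong[OF v, of "\<lambda>v. v $ i"] that by simp
    then show "\<forall>v\<in>u ` {..d}. a v = \<zero>\<^bsub>class_ring\<^esub>" by simp
  qed (use sub in auto)
  have "span (u ` {..d}) = carrier C"
  proof
    show "span (u ` {..d}) \<subseteq> carrier C" using sub by (rule span_is_subset2)
    show "carrier C \<subseteq> span (u ` {..d})"
    proof
      fix y assume "y \<in> carrier C"
      then obtain v where v: "y = comb d C u v" using surj by auto
      have "lincomb (\<lambda>z. v $ the_inv_into {..d} u z) (u ` {..d}) = y"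
        unfolding v by (rule comb_eq_lincomb[OF u u_inj]) (simp add: the_inv_into_f_f[OF u_inj])
      then show "y \<in> span (u ` {..d})" using finite_span[OF _ sub] by auto
    qed
  qed
  then show "basis_family d C u"
    unfolding basis_family_def basis_def using u_inj li sub by simp
qed

end

lemma comb_hom:
  assumes "class_algebra C" "class_algebra D" "f \<in> LinearCombinations.module_hom class_ring C D"
    "u \<in> {..d} \<rightarrow> carrier C"
  shows "f (comb d C u v) = comb d D (f \<circ> u) v"
proof -
  interpret C: class_algebra C by fact
  interpret D: class_algebra D by fact
  interpret mod_hom class_ring C D f
    by (unfold_locales) fact
  have "f (\<Oplus>\<^bsub>C\<^esub>i\<in>A. g i) = (\<Oplus>\<^bsub>D\<^esub>i\<in>A. f (g i))" if "finite A" "g \<in> A \<rightarrow> carrier C" for A :: "nat set" and g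
    using that
  proof (induction A rule: finite_induct)
    case (insert a A)
    then have "g \<in> A \<rightarrow> carrier C" "g a \<in> carrier C" by auto
    with insert show ?case
      using C.finsum_insert[of A a g] D.finsum_insert[of A a "\<lambda>i. f (g i)"] by (auto simp: Pi_iff)
  qed simp
  then have "f (comb d C u v) = (\<Oplus>\<^bsub>D\<^esub>i\<in>{..d}. f (v $ i \<odot>\<^bsub>C\<^esub> u i))"
    unfolding comb_def using assms(4) by (simp add: Pi_iff)
  also have "\<dots> = comb d D (f \<circ> u) v"
    unfolding comb_def
    by (rule D.finsum_cong') (use assms(4) f_im f_smult in \<open>auto simp: Pi_iff\<close>)
  finally show ?thesis .
qed

lemma class_algebra_coord: "class_algebra (coord_algebra d :: ('a::field, 'a vec) module)"
proof -
  let ?C = "coord_algebra d :: ('a, 'a vec) module"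
  have "cring ?C"
  proof (rule cringI)
    show "abelian_group ?C"
    proof (rule abelian_groupI)
      fix x assume "x \<in> carrier ?C"
      then show "\<exists>y\<in>carrier ?C. y \<oplus>\<^bsub>?C\<^esub> x = \<zero>\<^bsub>?C\<^esub>"
        by (intro bexI[of _ "- x"]) (auto simp: coord_algebra_def)
    qed (auto simp: coord_algebra_def)
    show "Group.comm_monoid ?C"
      by (rule comm_monoidI) (auto simp: coord_algebra_def mult_ac)
  qed (auto simp: coord_algebra_def algebra_simps)
  then show ?thesis
    unfolding class_algebra_def
    by (intro algebraI class_cring.is_cring)
      (auto simp: coord_algebra_def add_smult_distrib_vec smult_add_distrib_vec
        smult_smult_assoc)
qed

lemma comb_coord:
  fixes v :: "'a::field vec"
  assumes "v \<in> carrier_vec (Suc d)"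
  shows "comb d (coord_algebra d) (unit_vec (Suc d)) v = v"
proof -
  interpret class_algebra "coord_algebra d :: ('a, 'a vec) module" by (rule class_algebra_coord)
  let ?g = "\<lambda>i. v $ i \<odot>\<^bsub>coord_algebra d\<^esub> unit_vec (Suc d) i"
  have c: "?g \<in> A \<rightarrow> carrier (coord_algebra d)" for A by (simp add: coord_algebra_def)
  \<comment> \<open>Generalized to index subsets for the induction: a partial sum is
    \<open>v\<close> with the entries outside \<open>A\<close> set to zero.\<close>
  have "finsum (coord_algebra d) ?g A = Matrix.vec (Suc d) (\<lambda>i. if i \<in> A then v $ i else 0)"
    if "finite A" "A \<subseteq> {..d}" for A
    using that
  proof (induction A rule: finite_induct)
    case empty
    then show ?case using finsum_empty[of ?g] by (auto simp: coord_algebra_def)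
  next
    case (insert a A)
    then have "finsum (coord_algebra d) ?g (insert a A) =
        ?g a \<oplus>\<^bsub>coord_algebra d\<^esub> Matrix.vec (Suc d) (\<lambda>i. if i \<in> A then v $ i else 0)"
      using finsum_insert[of A a ?g] c[of A] c[of "{a}"] by simp
    also have "\<dots> = Matrix.vec (Suc d) (\<lambda>i. if i \<in> insert a A then v $ i else 0)"
      using insert(2,4) by (intro eq_vecI) (auto simp: coord_algebra_def unit_vec_def)
    finally show ?case .
  qed
  from this[of "{..d}"] show ?thesis
    unfolding comb_def using assms by (auto simp: less_Suc_eq_le)
qed

context class_algebra
begin

text \<open>Both sides are linear in \<open>v\<close> and agree on unit vectors. Viewing the right
  side as a module homomorphism out of the coordinate algebra lets \<open>comb_hom\<close> do the
  extension by linearity.\<close>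

lemma comb_mat:
  assumes u: "u \<in> {..d} \<rightarrow> carrier C" and P: "P \<in> carrier_mat (Suc d) (Suc d)"
    and v: "v \<in> carrier_vec (Suc d)"
    and x: "\<And>j. j \<le> d \<Longrightarrow> x j = comb d C u (col P j)"
  shows "comb d C x v = comb d C u (P *\<^sub>v v)"
proof -
  let ?f = "\<lambda>w. comb d C u (P *\<^sub>v w)"
  have hom: "?f \<in> LinearCombinations.module_hom class_ring (coord_algebra d) C"
    unfolding LinearCombinations.module_hom_def
    using u P comb_add[OF u] comb_smult[OF u]
    by (auto simp: coord_algebra_def mult_add_distrib_mat_vec[OF P] mult_mat_vec[OF P])
  have "?f v = ?f (comb d (coord_algebra d) (unit_vec (Suc d)) v)"
    by (simp add: comb_coord[OF v])
  also have "\<dots> = comb d C (?f \<circ> unit_vec (Suc d)) v"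
    by (rule comb_hom[OF class_algebra_coord _ hom])
      (auto simp: coord_algebra_def class_algebra_axioms)
  also have "\<dots> = comb d C x v"
  proof (rule comb_cong)
    fix i assume "i \<le> d"
    then show "(?f \<circ> unit_vec (Suc d)) i = x i"
      using x P by (simp add: mult_unit_vec_eq_col)
  qed (use x u in auto)
  finally show ?thesis by simp
qed

lemma finsum_eq_comb_col:
  assumes u: "u \<in> {..d} \<rightarrow> carrier C"
    and R: "R \<in> carrier_mat (Suc d) (Suc d)" and j: "j \<le> d"
  shows "(\<Oplus>\<^bsub>C\<^esub>i\<in>{..d}. R $$ (i,j) \<odot>\<^bsub>C\<^esub> u i) = comb d C u (col R j)"
  unfolding comb_def
proof (rule finsum_cong')
  show "(\<lambda>i. col R j $ i \<odot>\<^bsub>C\<^esub> u i) \<in> {..d} \<rightarrow> carrier C"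
    using u by (intro funcsetI smult_closed_class) (rule funcset_mem)
  fix i assume "i \<in> {..d}"
  then have "col R j $ i = R $$ (i,j)" using R j by simp
  then show "R $$ (i,j) \<odot>\<^bsub>C\<^esub> u i = col R j $ i \<odot>\<^bsub>C\<^esub> u i" by (simp only:)
qed simp

text \<open>The definite description needs uniqueness: each column is a coordinate vector, and the
  coordinate map of a basis is injective.\<close>

lemma transition_matrix_eqI:
  assumes u: "basis_family d C u" and P: "P \<in> carrier_mat (Suc d) (Suc d)"
    and x: "\<And>j. j \<le> d \<Longrightarrow> x j = comb d C u (col P j)"
  shows "transition_matrix d C u x = P"
proof -
  have uc: "u \<in> {..d} \<rightarrow> carrier C" using u by (simp add: basis_family_iff)
  have eq: "(\<Oplus>\<^bsub>C\<^esub>i\<in>{..d}. R $$ (i,j) \<odot>\<^bsub>C\<^esub> u i) = comb d C u (col R j)"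
    if "R \<in> carrier_mat (Suc d) (Suc d)" "j \<le> d" for R j
    using finsum_eq_comb_col[OF uc that] .
  have uniq: "R = P" if R: "R \<in> carrier_mat (Suc d) (Suc d)"
    and xR: "\<And>j. j \<le> d \<Longrightarrow> x j = comb d C u (col R j)" for R
  proof (rule mat_col_eqI)
    fix j assume "j < dim_col P"
    then have j: "j \<le> d" using P by auto
    have "inj_on (comb d C u) (carrier_vec (Suc d))"
      using u unfolding basis_family_iff bij_betw_def by blast
    moreover have "comb d C u (col R j) = comb d C u (col P j)" unfolding x[OF j, symmetric] xR[OF j, symmetric] ..
    moreover have "col R j \<in> carrier_vec (Suc d)" "col P j \<in> carrier_vec (Suc d)"
      using j by (auto intro: col_carrier_vec[OF _ R] col_carrier_vec[OF _ P])
    ultimately show "col R j = col P j" by (rule inj_onD)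
  qed (simp_all add: carrier_matD[OF R] carrier_matD[OF P])
  show ?thesis
    unfolding transition_matrix_def
  proof (rule the_equality)
    show "P \<in> carrier_mat (Suc d) (Suc d) \<and>
        (\<forall>j\<le>d. x j = (\<Oplus>\<^bsub>C\<^esub>i\<in>{..d}. P $$ (i,j) \<odot>\<^bsub>C\<^esub> u i))"
    proof (intro conjI allI impI P)
      fix j assume j: "j \<le> d"
      show "x j = (\<Oplus>\<^bsub>C\<^esub>i\<in>{..d}. P $$ (i,j) \<odot>\<^bsub>C\<^esub> u i)"
        unfolding x[OF j] eq[OF P j] ..
    qed
  next
    fix R assume R: "R \<in> carrier_mat (Suc d) (Suc d) \<and>
        (\<forall>j\<le>d. x j = (\<Oplus>\<^bsub>C\<^esub>i\<in>{..d}. R $$ (i,j) \<odot>\<^bsub>C\<^esub> u i))"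
    show "R = P"
    proof (rule uniq)
      show "R \<in> carrier_mat (Suc d) (Suc d)" using R by blast
      then show "x j = comb d C u (col R j)" if "j \<le> d" for j
        unfolding eq[OF \<open>R \<in> carrier_mat (Suc d) (Suc d)\<close> that, symmetric] using R that by blast
    qed
  qed
qed

text \<open>Existence: surjectivity of the coordinate map supplies each column.\<close>

lemma transition_matrix:
  assumes u: "basis_family d C u" and x: "x \<in> {..d} \<rightarrow> carrier C"
  shows "transition_matrix d C u x \<in> carrier_mat (Suc d) (Suc d)"
    "j \<le> d \<Longrightarrow> x j = comb d C u (col (transition_matrix d C u x) j)"
proof -
  have "\<exists>v\<in>carrier_vec (Suc d). x j = comb d C u v" if "j \<le> d" for j
    using u x that by (auto simp: basis_family_iff bij_betw_def)
  then obtain p where p: "\<And>j. j \<le> d \<Longrightarrow> p j \<in> carrier_vec (Suc d) \<and> x j = comb d C u (p j)"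
    by metis
  define P where "P = Matrix.mat (Suc d) (Suc d) (\<lambda>(i,j). p j $ i)"
  have P: "P \<in> carrier_mat (Suc d) (Suc d)" by (simp add: P_def)
  have "col P j = p j" if "j \<le> d" for j
    using p[OF that] that by (intro eq_vecI) (auto simp: P_def)
  then have "transition_matrix d C u x = P"
    using p by (intro transition_matrix_eqI[OF u P]) auto
  then show "transition_matrix d C u x \<in> carrier_mat (Suc d) (Suc d)"
    "j \<le> d \<Longrightarrow> x j = comb d C u (col (transition_matrix d C u x) j)"
    using P p \<open>\<And>j. j \<le> d \<Longrightarrow> col P j = p j\<close> by auto
qed

end

section \<open>Algebras with a basis of orthogonal idempotents\<close>

locale idempotent_algebra = class_algebra C
  for C :: "('a::field, 'c) module" (structure) +
  fixes d :: nat and e :: "nat \<Rightarrow> 'c"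
  assumes primitive_idempotents: "primitive_idempotents d C e"
begin

lemma e_basis: "basis_family d C e"
  using primitive_idempotents by (simp add: primitive_idempotents_def)

lemma e_closed: "e \<in> {..d} \<rightarrow> carrier C"
  using e_basis by (simp add: basis_family_iff)

lemma comb_e_bij: "bij_betw (comb d C e) (carrier_vec (Suc d)) (carrier C)"
  using e_basis by (simp add: basis_family_iff)

lemma comb_e_inj:
  assumes "comb d C e v = comb d C e w" "v \<in> carrier_vec (Suc d)" "w \<in> carrier_vec (Suc d)"
  shows "v = w"
  using comb_e_bij assms by (auto simp: bij_betw_def dest: inj_onD)

text \<open>Orthogonality kills the mixed products of idempotents, so coordinates multiply
  entrywise.\<close>

lemma comb_e_mult:
  "comb d C e v \<otimes>\<^bsub>C\<^esub> comb d C e w = comb d C e (Matrix.vec (Suc d) (\<lambda>i. v $ i * w $ i))"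
proof -
  have e: "e i \<in> carrier C" if "i \<le> d" for i using e_closed that by auto
  have idem: "e i \<otimes>\<^bsub>C\<^esub> e j = (if i = j then e i else \<zero>\<^bsub>C\<^esub>)" if "i \<le> d" "j \<le> d" for i j
    using primitive_idempotents that by (simp add: primitive_idempotents_def)
  have single: "v $ i \<odot>\<^bsub>C\<^esub> e i \<otimes>\<^bsub>C\<^esub> comb d C e w = (v $ i * w $ i) \<odot>\<^bsub>C\<^esub> e i" if i: "i \<le> d" for i
  proof -
    have "e i \<otimes>\<^bsub>C\<^esub> comb d C e w = (\<Oplus>\<^bsub>C\<^esub>j\<in>{..d}. e i \<otimes>\<^bsub>C\<^esub> (w $ j \<odot>\<^bsub>C\<^esub> e j))"
      unfolding comb_def by (rule finsum_rdistr) (use e i in auto)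
    also have "\<dots> = (\<Oplus>\<^bsub>C\<^esub>j\<in>{..d}. if i = j then w $ j \<odot>\<^bsub>C\<^esub> e j else \<zero>\<^bsub>C\<^esub>)"
    proof (rule finsum_cong')
      fix j assume "j \<in> {..d}"
      then have j: "j \<le> d" by simp
      \<comment> \<open>The algebra axiom moves scalars out of the left factor; commutativity brings
        the scaled factor there.\<close>
      have "e i \<otimes>\<^bsub>C\<^esub> (w $ j \<odot>\<^bsub>C\<^esub> e j) = (w $ j \<odot>\<^bsub>C\<^esub> e j) \<otimes>\<^bsub>C\<^esub> e i"
        using e i j by (intro m_comm) auto
      also have "\<dots> = w $ j \<odot>\<^bsub>C\<^esub> (e j \<otimes>\<^bsub>C\<^esub> e i)"
        using smult_assoc2[of "w $ j" "e j" "e i"] e i j by simp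
      finally show "e i \<otimes>\<^bsub>C\<^esub> (w $ j \<odot>\<^bsub>C\<^esub> e j) = (if i = j then w $ j \<odot>\<^bsub>C\<^esub> e j else \<zero>\<^bsub>C\<^esub>)"
        using idem[OF j i] smult_r_null by simp
    qed (use e in auto)
    also have "\<dots> = w $ i \<odot>\<^bsub>C\<^esub> e i"
      by (rule add.finprod_singleton) (use e i in auto)
    finally have "e i \<otimes>\<^bsub>C\<^esub> comb d C e w = w $ i \<odot>\<^bsub>C\<^esub> e i" .
    then show ?thesis
      using smult_assoc2[of "v $ i" "e i" "comb d C e w"] smult_assoc1[of "v $ i" "w $ i" "e i"]
        e[OF i] comb_closed[OF e_closed] by simp
  qed
  have "comb d C e v \<otimes>\<^bsub>C\<^esub> comb d C e w = (\<Oplus>\<^bsub>C\<^esub>i\<in>{..d}. v $ i \<odot>\<^bsub>C\<^esub> e i \<otimes>\<^bsub>C\<^esub> comb d C e w)"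
    unfolding comb_def[of d C e v]
    by (rule finsum_ldistr) (use e comb_closed[OF e_closed] in auto)
  also have "\<dots> = comb d C e (Matrix.vec (Suc d) (\<lambda>i. v $ i * w $ i))"
    unfolding comb_def[of d C e "Matrix.vec _ _"]
    by (rule finsum_cong') (use single e in auto)
  finally show ?thesis .
qed

lemma comb_e_one: "comb d C e (Matrix.vec (Suc d) (\<lambda>_. 1)) = \<one>\<^bsub>C\<^esub>"
proof -
  have "comb d C e (Matrix.vec (Suc d) (\<lambda>_. 1)) = (\<Oplus>\<^bsub>C\<^esub>i\<in>{..d}. e i)"
    unfolding comb_def by (rule finsum_cong') (use e_closed smult_one in \<open>auto simp: Pi_iff\<close>)
  then show ?thesis using primitive_idempotents by (simp add: primitive_idempotents_def)
qed

lemma comb_e_hom: "comb d C e \<in> algebra_hom (coord_algebra d) C"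
  unfolding algebra_hom_def LinearCombinations.module_hom_def Ring.ring_hom_def
  using comb_e_mult comb_e_one comb_add[OF e_closed] comb_smult[OF e_closed]
    comb_closed[OF e_closed]
  by (auto simp: coord_algebra_def)

definition coords :: "'c \<Rightarrow> 'a vec" where
  "coords = the_inv_into (carrier_vec (Suc d)) (comb d C e)"

lemma coords_comb_e: "v \<in> carrier_vec (Suc d) \<Longrightarrow> coords (comb d C e v) = v"
  unfolding coords_def using comb_e_bij by (auto simp: bij_betw_def intro: the_inv_into_f_f)

lemma comb_e_coords: "y \<in> carrier C \<Longrightarrow> comb d C e (coords y) = y"
  unfolding coords_def using comb_e_bij by (rule f_the_inv_into_f_bij_betw)

lemma coords_closed: "y \<in> carrier C \<Longrightarrow> coords y \<in> carrier_vec (Suc d)"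
  unfolding coords_def using comb_e_bij
  by (metis bij_betw_apply bij_betw_the_inv_into)

lemma coords_bij: "bij_betw coords (carrier C) (carrier_vec (Suc d))"
  unfolding coords_def using comb_e_bij by (rule bij_betw_the_inv_into)

lemma coords_e: "i \<le> d \<Longrightarrow> coords (e i) = unit_vec (Suc d) i"
  using coords_comb_e[of "unit_vec (Suc d) i"] comb_unit_vec[OF e_closed] by simp

lemma coords_hom: "coords \<in> algebra_hom C (coord_algebra d)"
proof -
  have "coords (x \<otimes>\<^bsub>C\<^esub> y) = Matrix.vec (Suc d) (\<lambda>i. coords x $ i * coords y $ i)"
    if "x \<in> carrier C" "y \<in> carrier C" for x y
    using comb_e_mult[of "coords x" "coords y"] that comb_e_coords
      coords_comb_e[of "Matrix.vec (Suc d) (\<lambda>i. coords x $ i * coords y $ i)"] by simp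
  moreover have "coords (x \<oplus>\<^bsub>C\<^esub> y) = coords x + coords y" if "x \<in> carrier C" "y \<in> carrier C" for x y
    using comb_add[OF e_closed, of "coords x" "coords y"] that comb_e_coords coords_closed
      coords_comb_e[of "coords x + coords y"] by simp
  moreover have "coords (a \<odot>\<^bsub>C\<^esub> x) = a \<cdot>\<^sub>v coords x" if "x \<in> carrier C" for a x
    using comb_smult[OF e_closed, of "coords x" a] that comb_e_coords coords_closed
      coords_comb_e[of "a \<cdot>\<^sub>v coords x"] by simp
  moreover have "coords \<one>\<^bsub>C\<^esub> = Matrix.vec (Suc d) (\<lambda>_. 1)"
    using coords_comb_e[of "Matrix.vec (Suc d) (\<lambda>_. 1)"] comb_e_one by simp
  ultimately show ?thesis
    unfolding algebra_hom_def LinearCombinations.module_hom_def Ring.ring_hom_def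
    using coords_closed by (auto simp: coord_algebra_def)
qed

text \<open>Multiplication by \<open>e 0\<close> retains only coordinate 0. Applying
  \<open>\<phi>\<close> to this product and cancelling \<open>\<phi> (e 0)\<close> leaves the
  coordinate.\<close>

lemma hom_eq_coord_0:
  assumes hom: "\<phi> \<in> algebra_hom C field_algebra" and nz: "\<phi> (e 0) \<noteq> 0"
    and v: "v \<in> carrier_vec (Suc d)"
  shows "\<phi> (comb d C e v) = v $ 0"
proof -
  have mult: "\<phi> (x \<otimes>\<^bsub>C\<^esub> y) = \<phi> x * \<phi> y" if "x \<in> carrier C" "y \<in> carrier C" for x y
    using hom that by (auto simp: algebra_hom_def Ring.ring_hom_def field_algebra_def)
  have smult: "\<phi> (a \<odot>\<^bsub>C\<^esub> x) = a * \<phi> x" if "x \<in> carrier C" for a x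
    using hom that by (auto simp: algebra_hom_def LinearCombinations.module_hom_def field_algebra_def)
  let ?u = "unit_vec (Suc d) 0 :: 'a vec"
  have "Matrix.vec (Suc d) (\<lambda>i. v $ i * ?u $ i) = v $ 0 \<cdot>\<^sub>v ?u"
    using v by (intro eq_vecI) (auto simp: unit_vec_def)
  then have "comb d C e v \<otimes>\<^bsub>C\<^esub> e 0 = v $ 0 \<odot>\<^bsub>C\<^esub> e 0"
    using comb_e_mult[of v ?u] comb_smult[OF e_closed, of ?u "v $ 0"] comb_unit_vec[OF e_closed, of 0]
    by simp
  then have "\<phi> (comb d C e v) * \<phi> (e 0) = v $ 0 * \<phi> (e 0)"
    using mult[of "comb d C e v" "e 0"] smult[of "e 0" "v $ 0"] e_closed by (auto simp: Pi_iff)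
  then show ?thesis using nz by simp
qed

section \<open>The character system axioms as equations for the coordinate matrix\<close>

text \<open>The condition on \<open>p 0 i j\<close> becomes an orthogonality relation between
  columns of \<open>P\<close>, weighted by row 0 of \<open>Q\<close>. Read as a matrix identity and
  multiplied by \<open>Q\<close>, it yields the required equations.\<close>

lemma eigenmatrix_pair_if_character_system:
  assumes cs: "character_system d (C, x, e)"
    and P: "P \<in> carrier_mat (Suc d) (Suc d)"
    and x: "\<And>j. j \<le> d \<Longrightarrow> x j = comb d C e (col P j)"
  shows "\<exists>Q. eigenmatrix_pair d P Q"
proof -
  have x0: "x 0 = \<one>\<^bsub>C\<^esub>" and basis: "basis_family d C x"
    and triv: "trivial_idempotent d C x (e 0)"
    using cs by (auto simp: character_system_def character_algebra_def)
  obtain \<phi> k p where hom: "\<phi> \<in> algebra_hom C field_algebra" and nz: "\<phi> (e 0) \<noteq> 0"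
    and k0: "\<And>i. i \<le> d \<Longrightarrow> k i \<noteq> 0" and sc: "structure_constants d C x p"
    and p0: "\<And>i j. i \<le> d \<Longrightarrow> j \<le> d \<Longrightarrow> p 0 i j = (if i = j then k i else 0)"
    and \<phi>k: "\<And>i. i \<le> d \<Longrightarrow> \<phi> (x i) = k i"
    using triv unfolding trivial_idempotent_def valency_hom_def valencies_def by blast
  have colP: "col P j \<in> carrier_vec (Suc d)" if "j \<le> d" for j
    using col_carrier_vec[OF _ P, of j] that by simp
  have k: "k j = P $$ (0,j)" if "j \<le> d" for j
    using hom_eq_coord_0[OF hom nz colP[OF that]] \<phi>k[OF that] x[OF that] that P by simp
  have comb_x: "comb d C x v = comb d C e (P *\<^sub>v v)" if "v \<in> carrier_vec (Suc d)" for v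
    by (rule comb_mat[OF e_closed P that x])
  \<comment> \<open>Column \<open>j\<close> of the inverse consists of the coordinates of
    \<open>e j\<close> in the basis \<open>x\<close>.\<close>
  have "\<exists>q\<in>carrier_vec (Suc d). P *\<^sub>v q = unit_vec (Suc d) j" if j: "j \<le> d" for j
  proof -
    have "e j \<in> comb d C x ` carrier_vec (Suc d)"
      using basis e_closed j by (auto simp: basis_family_iff bij_betw_def)
    then obtain q where q: "q \<in> carrier_vec (Suc d)" "e j = comb d C x q" by auto
    then have "comb d C e (unit_vec (Suc d) j) = comb d C e (P *\<^sub>v q)"
      using comb_unit_vec[OF e_closed j] comb_x by simp
    then have "unit_vec (Suc d) j = P *\<^sub>v q"
      by (rule comb_e_inj) (use P q in auto)
    then show ?thesis using q by auto
  qed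
  then obtain q where q: "\<And>j. j \<le> d \<Longrightarrow> q j \<in> carrier_vec (Suc d) \<and> P *\<^sub>v q j = unit_vec (Suc d) j"
    by metis
  define Q where "Q = Matrix.mat (Suc d) (Suc d) (\<lambda>(i,j). q j $ i)"
  have Q: "Q \<in> carrier_mat (Suc d) (Suc d)" by (simp add: Q_def)
  have PQ: "P * Q = 1\<^sub>m (Suc d)"
  proof (rule mat_col_eqI)
    fix j assume "j < dim_col (1\<^sub>m (Suc d) :: 'a mat)"
    then have j: "j \<le> d" "j < Suc d" by auto
    have "col Q j = q j"
      using q[OF j(1)] j by (intro eq_vecI) (auto simp: Q_def)
    then show "col (P * Q) j = col (1\<^sub>m (Suc d)) j"
      using q[OF j(1)] j col_mult2[OF P Q j(2)] by simp
  qed (use P Q in auto)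
  have QP: "Q * P = 1\<^sub>m (Suc d)" using mat_mult_left_right_inverse[OF P Q PQ] .
  have "comb d C e (col P 0) = comb d C e (Matrix.vec (Suc d) (\<lambda>_. 1))"
    using x[of 0] x0 comb_e_one by simp
  then have col0: "col P 0 = Matrix.vec (Suc d) (\<lambda>_. 1)"
    by (rule comb_e_inj) (use colP in auto)
  have P1: "P $$ (i,0) = 1" if "i \<le> d" for i
    using arg_cong[OF col0, of "\<lambda>v. v $ i"] that P by simp
  have orth: "(\<Sum>l<Suc d. Q $$ (0,l) * (P $$ (l,i) * P $$ (l,j))) = (if i = j then P $$ (0,i) else 0)"
    if ij: "i \<le> d" "j \<le> d" for i j
  proof -
    \<comment> \<open>\<open>?w\<close> and \<open>?p\<close> are the coordinates of the product of
      \<open>x i\<close> and \<open>x j\<close> in the bases \<open>e\<close> and \<open>x\<close>;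
      \<open>Q\<close> turns the first into the second.\<close>
    let ?w = "Matrix.vec (Suc d) (\<lambda>l. col P i $ l * col P j $ l)"
    let ?p = "Matrix.vec (Suc d) (\<lambda>h. p h i j)"
    have "comb d C e ?w = x i \<otimes>\<^bsub>C\<^esub> x j"
      using comb_e_mult x ij by simp
    also have "\<dots> = (\<Oplus>\<^bsub>C\<^esub>h\<in>{..d}. p h i j \<odot>\<^bsub>C\<^esub> x h)"
      using sc ij by (simp add: structure_constants_def)
    also have "\<dots> = comb d C x ?p"
      unfolding comb_def
      by (rule finsum_cong') (use basis in \<open>auto simp: basis_family_iff Pi_iff\<close>)
    also have "\<dots> = comb d C e (P *\<^sub>v ?p)" by (rule comb_x) simp
    finally have "?w = P *\<^sub>v ?p" by (rule comb_e_inj) (use P in auto)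
    then have "Q *\<^sub>v ?w = ?p"
      using assoc_mult_mat_vec[OF Q P, of ?p] QP by simp
    then have "(Q *\<^sub>v ?w) $ 0 = p 0 i j" by simp
    moreover have "(Q *\<^sub>v ?w) $ 0 = (\<Sum>l<Suc d. Q $$ (0,l) * (P $$ (l,i) * P $$ (l,j)))"
      using P Q ij by (simp add: scalar_prod_def lessThan_atLeast0 del: sum.lessThan_Suc)
    ultimately show ?thesis using p0[OF ij] k[OF ij(1)] by (auto simp del: sum.lessThan_Suc)
  qed
  \<comment> \<open>With this \<open>A\<close> the relations \<open>orth\<close> say that
    \<open>A * P\<close> is diagonal; right multiplication by \<open>Q\<close> then computes
    \<open>A\<close> a second time.\<close>
  define A where "A = Matrix.mat (Suc d) (Suc d) (\<lambda>(i,l). Q $$ (0,l) * P $$ (l,i))"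
  have A: "A \<in> carrier_mat (Suc d) (Suc d)" by (simp add: A_def)
  have AP: "A * P = mat_diag (Suc d) (\<lambda>i. P $$ (0,i))"
  proof (rule eq_matI)
    fix i j assume "i < dim_row (mat_diag (Suc d) (\<lambda>i. P $$ (0,i)))"
      "j < dim_col (mat_diag (Suc d) (\<lambda>i. P $$ (0,i)))"
    then have ij: "i \<le> d" "j \<le> d" by (auto simp: mat_diag_def)
    then have "(A * P) $$ (i,j) = (\<Sum>l<Suc d. Q $$ (0,l) * (P $$ (l,i) * P $$ (l,j)))"
      using P by (simp add: A_def scalar_prod_def lessThan_atLeast0 mult.assoc del: sum.lessThan_Suc)
    then show "(A * P) $$ (i,j) = mat_diag (Suc d) (\<lambda>i. P $$ (0,i)) $$ (i,j)"
      using orth[OF ij] ij by (simp add: mat_diag_def)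
  qed (use A P in \<open>auto simp: mat_diag_def\<close>)
  have "A = A * P * Q" using assoc_mult_mat[OF A P Q] PQ A by simp
  then have "A = Matrix.mat (Suc d) (Suc d) (\<lambda>(i,l). P $$ (0,i) * Q $$ (i,l))"
    unfolding AP using Q by (simp add: mat_diag_mult_left)
  then have eq: "A $$ (i,l) = P $$ (0,i) * Q $$ (i,l)" if "i \<le> d" "l \<le> d" for i l
    using that by simp
  have "P $$ (0,i) * Q $$ (i,l) = Q $$ (0,l) * P $$ (l,i)" if "i \<le> d" "l \<le> d" for i l
    unfolding eq[OF that, symmetric] A_def using that by simp
  moreover have "P $$ (0,i) \<noteq> 0" if "i \<le> d" for i using k0 k that by auto
  ultimately have "eigenmatrix_pair d P Q"
    unfolding eigenmatrix_pair_def using P Q PQ QP P1 by blast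
  then show ?thesis ..
qed

text \<open>Structure constants come from converting entrywise products back to the basis
  \<open>x\<close> by \<open>Q\<close>. The valencies are row 0 of \<open>P\<close>, and the valency
  homomorphism is the coordinate at \<open>e 0\<close>.\<close>

lemma character_system_if_eigenmatrix_pair:
  assumes pair: "eigenmatrix_pair d P Q"
    and x: "\<And>j. j \<le> d \<Longrightarrow> x j = comb d C e (col P j)"
  shows "character_system d (C, x, e)"
proof -
  have P: "P \<in> carrier_mat (Suc d) (Suc d)" and Q: "Q \<in> carrier_mat (Suc d) (Suc d)"
    and PQ: "P * Q = 1\<^sub>m (Suc d)" and QP: "Q * P = 1\<^sub>m (Suc d)"
    and P1: "\<And>i. i \<le> d \<Longrightarrow> P $$ (i,0) = 1" and P0: "\<And>i. i \<le> d \<Longrightarrow> P $$ (0,i) \<noteq> 0"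
    and eq: "\<And>i l. i \<le> d \<Longrightarrow> l \<le> d \<Longrightarrow> P $$ (0,i) * Q $$ (i,l) = Q $$ (0,l) * P $$ (l,i)"
    using pair unfolding eigenmatrix_pair_def by auto
  have colP: "col P j \<in> carrier_vec (Suc d)" if "j \<le> d" for j
    using col_carrier_vec[OF _ P, of j] that by simp
  have x_closed: "x \<in> {..d} \<rightarrow> carrier C" using x comb_closed[OF e_closed] by simp
  have comb_x: "comb d C x v = comb d C e (P *\<^sub>v v)" if "v \<in> carrier_vec (Suc d)" for v
    by (rule comb_mat[OF e_closed P that x])
  have "bij_betw (comb d C e \<circ> (*\<^sub>v) P) (carrier_vec (Suc d)) (carrier C)"
    by (rule bij_betw_trans[OF mult_mat_vec_bij[OF P Q PQ QP] comb_e_bij])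
  then have "bij_betw (comb d C x) (carrier_vec (Suc d)) (carrier C)"
    using bij_betw_cong[of "carrier_vec (Suc d)" "comb d C x" "comb d C e \<circ> (*\<^sub>v) P"] comb_x by simp
  then have basis: "basis_family d C x" using x_closed by (simp add: basis_family_iff)
  have "col P 0 = Matrix.vec (Suc d) (\<lambda>_. 1)"
    using P P1 by (intro eq_vecI) auto
  then have x0: "x 0 = \<one>\<^bsub>C\<^esub>" using x[of 0] comb_e_one by simp
  define w where "w i j = Matrix.vec (Suc d) (\<lambda>l. col P i $ l * col P j $ l)" for i j
  have w: "w i j \<in> carrier_vec (Suc d)" for i j by (simp add: w_def)
  have "x i \<otimes>\<^bsub>C\<^esub> x j = (\<Oplus>\<^bsub>C\<^esub>h\<in>{..d}. (Q *\<^sub>v w i j) $ h \<odot>\<^bsub>C\<^esub> x h)"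
    if ij: "i \<le> d" "j \<le> d" for i j
  proof -
    have "x i \<otimes>\<^bsub>C\<^esub> x j = comb d C e (w i j)" using comb_e_mult x ij by (simp add: w_def)
    also have "w i j = P *\<^sub>v (Q *\<^sub>v w i j)"
      using assoc_mult_mat_vec[OF P Q w[of i j]] PQ w[of i j] by simp
    also have "comb d C e (P *\<^sub>v (Q *\<^sub>v w i j)) = comb d C x (Q *\<^sub>v w i j)"
      by (rule comb_x[symmetric]) (rule mult_mat_vec_carrier[OF Q w])
    finally show ?thesis by (simp add: comb_def)
  qed
  then have sc: "structure_constants d C x (\<lambda>h i j. (Q *\<^sub>v w i j) $ h)"
    by (simp add: structure_constants_def)
  have "(Q *\<^sub>v w i j) $ 0 = (if i = j then P $$ (0,i) else 0)" if ij: "i \<le> d" "j \<le> d" for i j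
  proof -
    have "(Q *\<^sub>v w i j) $ 0 = (\<Sum>l<Suc d. (Q $$ (0,l) * P $$ (l,i)) * P $$ (l,j))"
      using P Q ij by (simp add: w_def scalar_prod_def lessThan_atLeast0 mult.assoc del: sum.lessThan_Suc)
    \<comment> \<open>The pair condition trades row 0 of \<open>Q\<close> for row \<open>i\<close>,
      after which the sum is an entry of \<open>Q * P\<close>.\<close>
    also have "\<dots> = (\<Sum>l<Suc d. P $$ (0,i) * Q $$ (i,l) * P $$ (l,j))"
      by (rule sum.cong) (simp_all add: eq[OF ij(1)])
    also have "\<dots> = P $$ (0,i) * (\<Sum>l<Suc d. Q $$ (i,l) * P $$ (l,j))"
      by (simp only: sum_distrib_left mult.assoc)
    also have "(\<Sum>l<Suc d. Q $$ (i,l) * P $$ (l,j)) = (Q * P) $$ (i,j)"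
      using P Q ij by (simp add: scalar_prod_def lessThan_atLeast0 del: sum.op_ivl_Suc)
    finally show ?thesis using ij by (simp add: QP)
  qed
  then have val: "valencies d C x (\<lambda>i. P $$ (0,i))"
    unfolding valencies_def using P0 sc by blast
  let ?\<phi> = "\<lambda>y. coords y $ 0"
  have "?\<phi> \<in> algebra_hom C field_algebra"
    using coords_hom carrier_vecD[OF coords_closed]
    by (auto simp: algebra_hom_def Ring.ring_hom_def LinearCombinations.module_hom_def
        coord_algebra_def field_algebra_def)
  moreover have "?\<phi> (x i) = P $$ (0,i)" if "i \<le> d" for i
    using x[OF that] coords_comb_e[OF colP[OF that]] P that by simp
  ultimately have \<phi>: "valency_hom d C x ?\<phi>"
    unfolding valency_hom_def using val by blast
  moreover have "?\<phi> (e 0) \<noteq> 0" by (simp add: coords_e)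
  ultimately have "trivial_idempotent d C x (e 0)"
    unfolding trivial_idempotent_def by blast
  then show ?thesis
    using \<phi> x0 basis primitive_idempotents algebra_axioms
    by (auto simp: character_system_def character_algebra_def)
qed

lemma character_system_iff_AON:
  assumes "P \<in> carrier_mat (Suc d) (Suc d)" "\<And>j. j \<le> d \<Longrightarrow> x j = comb d C e (col P j)"
  shows "character_system d (C, x, e) \<longleftrightarrow> P \<in> AON d"
  using eigenmatrix_pair_if_character_system[OF _ assms] AON_if_eigenmatrix_pair
    character_system_if_eigenmatrix_pair[OF _ assms(2)] eigenmatrix_pair_if_AON by blast

end

section \<open>The eigenmatrix as a complete isomorphism invariant\<close>

lemma character_system_eigenmatrix:
  assumes cs: "character_system d (C, x, e)"
  shows "idempotent_algebra C d e"
    "eigenmatrix d (C, x, e) \<in> AON d"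
    "eigenmatrix d (C, x, e) \<in> carrier_mat (Suc d) (Suc d)"
    "j \<le> d \<Longrightarrow> x j = comb d C e (col (eigenmatrix d (C, x, e)) j)"
proof -
  have alg: "algebra class_ring C" and basis: "basis_family d C x"
    and e: "primitive_idempotents d C e"
    using cs by (auto simp: character_system_def character_algebra_def)
  interpret idempotent_algebra C d e
    by (intro idempotent_algebra.intro class_algebra.intro idempotent_algebra_axioms.intro alg e)
  show "idempotent_algebra C d e" by unfold_locales
  have x: "x \<in> {..d} \<rightarrow> carrier C" using basis by (simp add: basis_family_iff)
  note P = transition_matrix[OF e_basis x]
  show "eigenmatrix d (C, x, e) \<in> carrier_mat (Suc d) (Suc d)"
    "j \<le> d \<Longrightarrow> x j = comb d C e (col (eigenmatrix d (C, x, e)) j)"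
    using P by (auto simp: eigenmatrix_def)
  show "eigenmatrix d (C, x, e) \<in> AON d"
    using character_system_iff_AON[of _ x, OF P] cs by (simp add: eigenmatrix_def)
qed

text \<open>An isomorphism matches the idempotents and therefore preserves coordinates. Conversely,
  matching the idempotents defines an algebra isomorphism, and equal coordinates make it match the
  \<open>x\<close> families too.\<close>

lemma char_system_iso_iff_eigenmatrix_eq:
  fixes \<Psi> :: "('a::field, 'b) char_system" and \<Phi> :: "('a, 'c) char_system"
  assumes "character_system d \<Psi>" "character_system d \<Phi>"
  shows "char_system_iso d \<Psi> \<Phi> \<longleftrightarrow> eigenmatrix d \<Psi> = eigenmatrix d \<Phi>"
proof -
  obtain C x e D y f where \<Psi>: "\<Psi> = (C, x, e)" and \<Phi>: "\<Phi> = (D, y, f)"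
    by (metis prod_cases3)
  note Ce = character_system_eigenmatrix[OF assms(1)[unfolded \<Psi>]]
  note Df = character_system_eigenmatrix[OF assms(2)[unfolded \<Phi>]]
  interpret C: idempotent_algebra C d e by (fact Ce(1))
  interpret D: idempotent_algebra D d f by (fact Df(1))
  have PC: "col (eigenmatrix d (C, x, e)) j \<in> carrier_vec (Suc d)" if "j \<le> d" for j
    using col_carrier_vec[OF _ Ce(3), of j] that by simp
  show ?thesis
  proof
    assume "char_system_iso d \<Psi> \<Phi>"
    then obtain g where g: "g \<in> algebra_hom C D" and gx: "\<And>i. i \<le> d \<Longrightarrow> g (x i) = y i"
      and ge: "\<And>i. i \<le> d \<Longrightarrow> g (e i) = f i"
      by (auto simp: \<Psi> \<Phi> char_system_iso_def)
    have "y j = comb d D f (col (eigenmatrix d (C, x, e)) j)" if j: "j \<le> d" for j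
    proof -
      have "y j = g (comb d C e (col (eigenmatrix d (C, x, e)) j))"
        using gx[OF j] Ce(4)[OF j] by simp
      also have "\<dots> = comb d D (g \<circ> e) (col (eigenmatrix d (C, x, e)) j)"
        by (rule comb_hom) (use g C.e_closed C.class_algebra_axioms D.class_algebra_axioms
            in \<open>auto simp: algebra_hom_def\<close>)
      also have "\<dots> = comb d D f (col (eigenmatrix d (C, x, e)) j)"
        by (rule D.comb_cong) (use ge D.e_closed in auto)
      finally show ?thesis .
    qed
    then show "eigenmatrix d \<Psi> = eigenmatrix d \<Phi>"
      using D.transition_matrix_eqI[OF D.e_basis Ce(3)] by (simp add: \<Psi> \<Phi> eigenmatrix_def)
  next
    assume eq: "eigenmatrix d \<Psi> = eigenmatrix d \<Phi>"
    \<comment> \<open>Reads off coordinates with respect to \<open>e\<close> and reuses them with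
      respect to \<open>f\<close>.\<close>
    let ?g = "comb d D f \<circ> C.coords"
    have "?g \<in> algebra_hom C D"
      using C.coords_hom D.comb_e_hom
      by (auto simp: algebra_hom_def Ring.ring_hom_def LinearCombinations.module_hom_def Pi_iff)
    moreover have "bij_betw ?g (carrier C) (carrier D)"
      by (rule bij_betw_trans[OF C.coords_bij D.comb_e_bij])
    moreover have "?g (x i) = y i" "?g (e i) = f i" if "i \<le> d" for i
    proof -
      show "?g (x i) = y i"
        using Ce(4)[OF that] Df(4)[OF that] C.coords_comb_e[OF PC[OF that]] eq
        by (simp add: \<Psi> \<Phi>)
      show "?g (e i) = f i"
        using C.coords_e[OF that] D.comb_unit_vec[OF D.e_closed that] by simp
    qed
    ultimately show "char_system_iso d \<Psi> \<Phi>"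
      unfolding \<Psi> \<Phi> char_system_iso_def by auto
  qed
qed

lemma eigenmatrix_AON:
  "character_system d \<Psi> \<Longrightarrow> eigenmatrix d \<Psi> \<in> AON d"
  by (cases \<Psi>) (blast intro: character_system_eigenmatrix(2))

section \<open>The character system of a matrix\<close>

lemma idempotent_algebra_coord: "idempotent_algebra (coord_algebra d) d (unit_vec (Suc d) :: nat \<Rightarrow> 'a::field vec)"
proof -
  let ?C = "coord_algebra d :: ('a, 'a vec) module" and ?e = "unit_vec (Suc d) :: nat \<Rightarrow> 'a vec"
  interpret class_algebra ?C by (rule class_algebra_coord)
  have e: "?e \<in> {..d} \<rightarrow> carrier ?C" by (simp add: coord_algebra_def)
  have "carrier ?C = carrier_vec (Suc d)" by (simp add: coord_algebra_def)
  moreover have "bij_betw (comb d ?C ?e) (carrier_vec (Suc d)) (carrier_vec (Suc d))"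
    by (rule bij_betw_byWitness[where f' = "\<lambda>v. v"]) (auto simp: comb_coord)
  ultimately have "bij_betw (comb d ?C ?e) (carrier_vec (Suc d)) (carrier ?C)" by (simp only:)
  then have basis: "basis_family d ?C ?e" using e by (simp add: basis_family_iff)
  have one_vec: "\<one>\<^bsub>?C\<^esub> = Matrix.vec (Suc d) (\<lambda>_. 1)" by (simp add: coord_algebra_def)
  have "Matrix.vec (Suc d) (\<lambda>_. 1) = comb d ?C ?e (Matrix.vec (Suc d) (\<lambda>_. 1))"
    by (rule comb_coord[symmetric]) simp
  also have "\<dots> = (\<Oplus>\<^bsub>?C\<^esub>i\<in>{..d}. ?e i)"
    unfolding comb_def
  proof (rule finsum_cong')
    fix i assume "i \<in> {..d}"
    then show "Matrix.vec (Suc d) (\<lambda>_. 1) $ i \<odot>\<^bsub>?C\<^esub> ?e i = ?e i"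
      by (simp add: coord_algebra_def)
  qed (use e in auto)
  finally have one: "\<one>\<^bsub>?C\<^esub> = (\<Oplus>\<^bsub>?C\<^esub>i\<in>{..d}. ?e i)"
    unfolding one_vec .
  have "primitive_idempotents d ?C ?e"
    unfolding primitive_idempotents_def
    using basis one coord_algebra_unit_vec by blast
  then show ?thesis
    by (intro idempotent_algebra.intro idempotent_algebra_axioms.intro class_algebra_axioms)
qed

lemma character_system_Psi:
  fixes P :: "'a::field mat"
  assumes "P \<in> AON d"
  shows "character_system d (Psi d P)" "eigenmatrix d (Psi d P) = P"
proof -
  let ?C = "coord_algebra d :: ('a, 'a vec) module" and ?e = "unit_vec (Suc d) :: nat \<Rightarrow> 'a vec"
  interpret idempotent_algebra ?C d ?e by (rule idempotent_algebra_coord)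
  have P: "P \<in> carrier_mat (Suc d) (Suc d)"
    using assms by (simp add: AON_def almost_orthogonal_def)
  let ?x = "\<lambda>j. \<Oplus>\<^bsub>?C\<^esub>i\<in>{..d}. P $$ (i,j) \<odot>\<^bsub>?C\<^esub> ?e i"
  have x: "?x j = comb d ?C ?e (col P j)" if "j \<le> d" for j
    by (rule finsum_eq_comb_col[OF e_closed P that])
  show "character_system d (Psi d P)"
    unfolding Psi_def using character_system_iff_AON[of P ?x, OF P x] assms by simp
  show "eigenmatrix d (Psi d P) = P"
    unfolding Psi_def eigenmatrix_def using transition_matrix_eqI[OF e_basis P, of ?x, OF x] by simp
qed

section \<open>Isomorphism classes and the two maps\<close>

lemma iso_class_eq:
  assumes "character_system d \<Psi>"
  shows "iso_class d \<Psi> = {\<Phi>. character_system d \<Phi> \<and> eigenmatrix d \<Phi> = eigenmatrix d \<Psi>}"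
  unfolding iso_class_def using char_system_iso_iff_eigenmatrix_eq[OF _ assms] by blast

text \<open>Classes contain only systems over \<open>'a vec\<close>, so for a system over another
  type nonemptiness requires a model; the eigenmatrix provides one.\<close>

lemma Psi_eigenmatrix_mem_iso_class:
  assumes "character_system d \<Psi>"
  shows "Psi d (eigenmatrix d \<Psi>) \<in> iso_class d \<Psi>"
  using character_system_Psi[OF eigenmatrix_AON[OF assms]] iso_class_eq[OF assms] by simp

lemma class_eigenmatrix_iso_class:
  assumes "character_system d \<Psi>"
  shows "class_eigenmatrix d (iso_class d \<Psi>) = eigenmatrix d \<Psi>"
proof -
  have "eigenmatrix d \<Phi> = eigenmatrix d \<Psi>" if "\<Phi> \<in> iso_class d \<Psi>" for \<Phi>
    using that unfolding iso_class_eq[OF assms] by blast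
  then show ?thesis
    unfolding class_eigenmatrix_def
    \<comment> \<open>All members share one eigenmatrix and a member exists, so the definite
      description is determined.\<close>
    using Psi_eigenmatrix_mem_iso_class[OF assms] by (intro the_equality) blast+
qed

lemma iso_class_Psi_eigenmatrix:
  assumes "character_system d \<Psi>"
  shows "iso_class d (Psi d (eigenmatrix d \<Psi>)) = iso_class d \<Psi>"
  unfolding iso_class_eq[OF assms] iso_class_eq[OF character_system_Psi(1)[OF eigenmatrix_AON[OF assms]]]
    character_system_Psi(2)[OF eigenmatrix_AON[OF assms]] ..

lemma iso_class_eq_iff:
  assumes "character_system d \<Psi>" "character_system d \<Phi>"
  shows "iso_class d \<Psi> = iso_class d \<Phi> \<longleftrightarrow> char_system_iso d \<Psi> \<Phi>"
proof
  assume "iso_class d \<Psi> = iso_class d \<Phi>"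
  then have "eigenmatrix d \<Psi> = eigenmatrix d \<Phi>"
    using class_eigenmatrix_iso_class[OF assms(1)] class_eigenmatrix_iso_class[OF assms(2)] by simp
  then show "char_system_iso d \<Psi> \<Phi>"
    by (simp only: char_system_iso_iff_eigenmatrix_eq[OF assms])
next
  assume "char_system_iso d \<Psi> \<Phi>"
  then show "iso_class d \<Psi> = iso_class d \<Phi>"
    by (simp only: char_system_iso_iff_eigenmatrix_eq[OF assms] iso_class_eq[OF assms(1)]
        iso_class_eq[OF assms(2)])
qed

text \<open>\<open>CS\<close> asks for a representative over \<open>'a vec\<close>; the model built
  from the eigenmatrix has the same class.\<close>

lemma iso_class_mem_CS:
  assumes "character_system d \<Psi>"
  shows "iso_class d \<Psi> \<in> CS d"
  unfolding CS_def
  using iso_class_Psi_eigenmatrix[OF assms] character_system_Psi(1)[OF eigenmatrix_AON[OF assms]]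
  by blast

theorem proposition11p4:
  fixes d :: nat
  shows
    "\<comment> \<open>both maps are well defined, also for systems with carriers in arbitrary types\<close>
     (\<forall>P \<in> (AON d :: 'a::field mat set). character_system d (Psi d P)) \<and>
     (\<lambda>P. iso_class d (Psi d P)) \<in> (AON d :: 'a mat set) \<rightarrow> CS d \<and>
     class_eigenmatrix d \<in> CS d \<rightarrow> (AON d :: 'a mat set) \<and>
     (\<forall>\<Psi> :: ('a, 'c) char_system. character_system d \<Psi> \<longrightarrow>
        iso_class d \<Psi> \<in> CS d \<and> class_eigenmatrix d (iso_class d \<Psi>) = eigenmatrix d \<Psi>) \<and>
     (\<forall>(\<Psi> :: ('a, 'c) char_system) (\<Phi> :: ('a, 'e) char_system).
        character_system d \<Psi> \<longrightarrow> character_system d \<Phi> \<longrightarrow>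
        (iso_class d \<Psi> = iso_class d \<Phi> \<longleftrightarrow> char_system_iso d \<Psi> \<Phi>)) \<and>
     \<comment> \<open>the maps are inverses\<close>
     (\<forall>P \<in> (AON d :: 'a mat set). class_eigenmatrix d (iso_class d (Psi d P)) = P) \<and>
     (\<forall>c \<in> (CS d :: ('a, 'a vec) char_system set set).
        iso_class d (Psi d (class_eigenmatrix d c)) = c)"
proof (intro conjI ballI allI impI funcsetI)
  fix c :: "('a, 'a vec) char_system set"
  assume "c \<in> CS d"
  then obtain \<Psi> :: "('a, 'a vec) char_system" where "character_system d \<Psi>" "c = iso_class d \<Psi>"
    unfolding CS_def by blast
  then show "class_eigenmatrix d c \<in> AON d" "iso_class d (Psi d (class_eigenmatrix d c)) = c"
    by (simp_all add: class_eigenmatrix_iso_class eigenmatrix_AON iso_class_Psi_eigenmatrix)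
qed (simp_all add: character_system_Psi iso_class_mem_CS class_eigenmatrix_iso_class iso_class_eq_iff)

end
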